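(* Let $A$ be a modal frame and consider a version of the point construction in which points are triples $(p,a,F)$; suppose that every point $(p,a,F)\in\mathbb{P}_A$ satisfies both $\{c\in A\mid p(\Diamond c)=0\}\subseteq\{c\in A\mid c\le a\}$ and $F\subseteq F_p$. Then: 1. If $\Box a\le a$ and $a\le\Diamond a$ for all $a\in A$, then $R_A$ is reflexive on $\mathbb{P}_A$. 2. If $\Diamond\Box a\le a$ and $a\le\Box\Diamond a$ for all $a\in A$, then $R_A$ is symmetric on $\mathbb{P}_A$. 3. If $\Box a\le\Box\Box a$ and $\Diamond\Diamond a\le\Diamond a$ for all $a\in A$, then $R_A$ is transitive on $\mathbb{P}_A$.
   Context: A modal frame $(A,\Box,\Diamond)$ is a frame $A$ with monotone maps $\Box,\Diamond:A\to A$ such that for all $a,b$: $\top\le\Box\top$; $\Box a\wedge\Box b\le\Box(a\wedge b)$; $\Box a\wedge\Diamond b\le\Diamond(a\wedge b)$; $\Diamond\bot\le\bot$. Point construction (triple versions). A frame character is a frame morphism $p:A\to\mathbf 2=\{0<1\}$; $\nabla(p)=\{a\mid p(a)=1\}$; $F_p=\{c\mid p(\Box c)=1\}$. Filters are nonempty up-closed subsets closed under binary meets (possibly all of $A$). A pre-point is a triple $(p,a,F)$ with $p$ a frame character, $a\in A$, $F\subseteq A$ a filter, satisfying $p(\Diamond a)=0$ and $F_p\subseteq F$, and, depending on the version, possibly also one or both of: $p(\Diamond c)=0\Rightarrow c\le a$ for all $c$; $F\subseteq F_p$. Define $(p,a,F)R_A(q,b,G)$ iff $q(a)=0$ and $F\subseteq\nabla(q)$.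 The set $\mathbb{P}_A$ of points is the largest set of pre-points such that for each $(p,a,F)\in\mathbb{P}_A$: for each $c\not\le a$ there is $(q,b,G)\in\mathbb{P}_A$ with $(p,a,F)R_A(q,b,G)$ and $q(c)=1$; and for each $c\notin F$ there is $(q,b,G)\in\mathbb{P}_A$ with $(p,a,F)R_A(q,b,G)$ and $q(c)=0$. *)

theory Defs
  imports Main
begin

class frame = complete_lattice +
  assumes inf_Sup_distrib: "inf a (Sup B) = Sup {inf a b | b. b \<in> B}"

text \<open>
  The two-element frame \<open>{0 < 1}\<close> is the type \<^typ>\<open>bool\<close>, with \<^term>\<open>False < True\<close>;
  so \<open>p a\<close> reads \<open>p(a) = 1\<close> and \<open>\<not> p a\<close> reads \<open>p(a) = 0\<close>.
\<close>

instance bool :: frame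
  by standard auto

definition frame_morphism :: "('a::frame \<Rightarrow> 'b::frame) \<Rightarrow> bool" where
  "frame_morphism f \<longleftrightarrow>
     f top = top \<and>
     (\<forall>x y. f (inf x y) = inf (f x) (f y)) \<and>
     (\<forall>S. f (Sup S) = Sup (f ` S))"

locale modal_frame =
  fixes box dia :: "'a::frame \<Rightarrow> 'a"
  assumes mono_box: "mono box"
    and mono_dia: "mono dia"
    and top_le_box_top: "top \<le> box top"
    and box_inf_box_le: "inf (box a) (box b) \<le> box (inf a b)"
    and box_inf_dia_le: "inf (box a) (dia b) \<le> dia (inf a b)"
    and dia_bot_le: "dia bot \<le> bot"

abbreviation frame_character :: "('a::frame \<Rightarrow> bool) \<Rightarrow> bool" where
  "frame_character p \<equiv> frame_morphism p"

definition nabla :: "('a::frame \<Rightarrow> bool) \<Rightarrow> 'a set" where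
  "nabla p = {a. p a}"

definition box_filter :: "('a::frame \<Rightarrow> 'a) \<Rightarrow> ('a \<Rightarrow> bool) \<Rightarrow> 'a set" where
  "box_filter box p = {c. p (box c)}"

definition frame_filter :: "'a::frame set \<Rightarrow> bool" where
  "frame_filter F \<longleftrightarrow>
     F \<noteq> {} \<and>
     (\<forall>x\<in>F. \<forall>y. x \<le> y \<longrightarrow> y \<in> F) \<and>
     (\<forall>x\<in>F. \<forall>y\<in>F. inf x y \<in> F)"

type_synonym 'a triple = "('a \<Rightarrow> bool) \<times> 'a \<times> 'a set"

text \<open>
  The flags \<open>v\<close> and \<open>w\<close> say which of the two optional conditions on pre-points are imposed,
  so their four values give the four versions of the construction.
\<close>

fun pre_point ::
  "bool \<Rightarrow> bool \<Rightarrow> ('a::frame \<Rightarrow> 'a) \<Rightarrow> ('a \<Rightarrow> 'a) \<Rightarrow> 'a triple \<Rightarrow> bool" where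
  "pre_point v w box dia (p, a, F) \<longleftrightarrow>
     frame_character p \<and> frame_filter F \<and>
     \<not> p (dia a) \<and> box_filter box p \<subseteq> F \<and>
     (v \<longrightarrow> (\<forall>c. \<not> p (dia c) \<longrightarrow> c \<le> a)) \<and>
     (w \<longrightarrow> F \<subseteq> box_filter box p)"

fun modal_rel :: "'a::frame triple \<Rightarrow> 'a triple \<Rightarrow> bool" where
  "modal_rel (p, a, F) (q, b, G) \<longleftrightarrow> \<not> q a \<and> F \<subseteq> nabla q"

definition point_system ::
  "bool \<Rightarrow> bool \<Rightarrow> ('a::frame \<Rightarrow> 'a) \<Rightarrow> ('a \<Rightarrow> 'a) \<Rightarrow> 'a triple set \<Rightarrow> bool" where
  "point_system v w box dia P \<longleftrightarrow>
     (\<forall>t\<in>P. pre_point v w box dia t) \<and>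
     (\<forall>(p, a, F)\<in>P.
        (\<forall>c. \<not> c \<le> a \<longrightarrow> (\<exists>(q, b, G)\<in>P. modal_rel (p, a, F) (q, b, G) \<and> q c)) \<and>
        (\<forall>c. c \<notin> F \<longrightarrow> (\<exists>(q, b, G)\<in>P. modal_rel (p, a, F) (q, b, G) \<and> \<not> q c)))"

definition points ::
  "bool \<Rightarrow> bool \<Rightarrow> ('a::frame \<Rightarrow> 'a) \<Rightarrow> ('a \<Rightarrow> 'a) \<Rightarrow> 'a triple set" where
  "points v w box dia = \<Union> {P. point_system v w box dia P}"

lemma point_system_points: "point_system v w box dia (points v w box dia)"
proof -
  let ?U = "points v w box dia"
  have pre: "pre_point v w box dia t" if "t \<in> ?U" for t
    using that unfolding points_def point_system_def by blast
  have cond: "(\<forall>c. \<not> c \<le> a \<longrightarrow> (\<exists>(q, b, G)\<in>?U. modal_rel (p, a, F) (q, b, G) \<and> q c)) \<and>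
      (\<forall>c. c \<notin> F \<longrightarrow> (\<exists>(q, b, G)\<in>?U. modal_rel (p, a, F) (q, b, G) \<and> \<not> q c))"
    if mem: "(p, a, F) \<in> ?U" for p a F
  proof -
    obtain P where P: "point_system v w box dia P" "(p, a, F) \<in> P"
      using mem unfolding points_def by blast
    have sub: "P \<subseteq> ?U"
      using P(1) unfolding points_def by blast
    have "(\<forall>c. \<not> c \<le> a \<longrightarrow> (\<exists>(q, b, G)\<in>P. modal_rel (p, a, F) (q, b, G) \<and> q c)) \<and>
      (\<forall>c. c \<notin> F \<longrightarrow> (\<exists>(q, b, G)\<in>P. modal_rel (p, a, F) (q, b, G) \<and> \<not> q c))"
      using P unfolding point_system_def by blast
    then show ?thesis
      using sub by (meson bexE bexI subsetD)
  qed
  show ?thesis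
    unfolding point_system_def using pre cond by blast
qed

lemma point_system_subset_points:
  "point_system v w box dia P \<Longrightarrow> P \<subseteq> points v w box dia"
  unfolding points_def by blast

end

(* If a and F are both determined by p, the relation R_A says exactly that
   p(box c) <= q(c) <= p(dia c) for all c; each claim then follows
   by chaining these inequalities with the monotonicity of characters. *)
theory Submission
  imports Defs
begin

lemma frame_morphism_mono:
  assumes "frame_morphism f"
  shows "mono f"
proof (rule monoI)
  fix x y :: 'a
  assume "x \<le> y"
  then have "f x = inf (f x) (f y)"
    using assms unfolding frame_morphism_def by (metis inf.absorb1)
  then show "f x \<le> f y"
    by (metis inf.cobounded2)
qed

lemma points_pre_point:
  "t \<in> points v w box dia \<Longrightarrow> pre_point v w box dia t"
  using point_system_points unfolding point_system_def by blast

text \<open>Being a pre-point gives \<open>p (dia a) = False\<close>, so by the third assumption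
  \<open>a\<close> is the greatest \<open>c\<close> with \<open>p (dia c) = False\<close>; likewise
  \<open>F\<close> is exactly \<open>box_filter box p\<close>. Stating both inclusions as
  assumptions, not through the flags \<open>v\<close> and \<open>w\<close>, covers all versions at
  once.\<close>

lemma modal_rel_iff:
  assumes p: "pre_point v w box dia (p, a, F)"
    and q: "frame_character q"
    and a: "{c. \<not> p (dia c)} \<subseteq> {c. c \<le> a}"
    and F: "F \<subseteq> box_filter box p"
  shows "modal_rel (p, a, F) (q, b, G) \<longleftrightarrow> (\<forall>c. (p (box c) \<longrightarrow> q c) \<and> (q c \<longrightarrow> p (dia c)))"
proof -
  \<comment> \<open>Left to right: if \<open>q c\<close> held without \<open>p (dia c)\<close>, then
    \<open>c \<le> a\<close> and monotonicity would give \<open>q a\<close>. Right to left: take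
    \<open>c = a\<close>.\<close>
  have "\<not> q a \<longleftrightarrow> (\<forall>c. q c \<longrightarrow> p (dia c))"
    using p a monoD[OF frame_morphism_mono[OF q]] by auto
  moreover have "F = box_filter box p"
    using p F by auto
  ultimately show ?thesis
    by (auto simp: box_filter_def nabla_def)
qed

theorem proposition1:
  fixes box dia :: "'a::frame \<Rightarrow> 'a" and v w :: bool
  assumes "modal_frame box dia"
    and "\<And>p a F. (p, a, F) \<in> points v w box dia \<Longrightarrow>
           {c. \<not> p (dia c)} \<subseteq> {c. c \<le> a} \<and> F \<subseteq> box_filter box p"
  shows "((\<forall>x. box x \<le> x \<and> x \<le> dia x) \<longrightarrow> reflp_on (points v w box dia) modal_rel) \<and>
         ((\<forall>x. dia (box x) \<le> x \<and> x \<le> box (dia x)) \<longrightarrow> symp_on (points v w box dia) modal_rel) \<and>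
         ((\<forall>x. box x \<le> box (box x) \<and> dia (dia x) \<le> dia x) \<longrightarrow> transp_on (points v w box dia) modal_rel)"
proof -
  let ?P = "points v w box dia"
  have char: "frame_character p" if "(p, a, F) \<in> ?P" for p a F
    using points_pre_point[OF that] by simp
  have le: "p y" if "(p, a, F) \<in> ?P" "p x" "x \<le> y" for p a F x y
    using monoD[OF frame_morphism_mono[OF char[OF that(1)]] that(3)] that(2) by simp
  have rel: "modal_rel (p, a, F) (q, b, G) \<longleftrightarrow>
      (\<forall>c. (p (box c) \<longrightarrow> q c) \<and> (q c \<longrightarrow> p (dia c)))"
    if "(p, a, F) \<in> ?P" "(q, b, G) \<in> ?P" for p a F q b G
    using modal_rel_iff[OF points_pre_point[OF that(1)] char[OF that(2)]] assms(2)[OF that(1)]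
    by blast
  have "reflp_on ?P modal_rel" if "\<forall>x. box x \<le> x \<and> x \<le> dia x"
  proof (rule reflp_onI)
    fix s assume s: "s \<in> ?P"
    obtain p a F where "s = (p, a, F)" by (cases s)
    \<comment> \<open>\<open>p (box c)\<close> gives \<open>p c\<close>, which gives
      \<open>p (dia c)\<close>.\<close>
    with s show "modal_rel s s"
      using rel le that by (metis (no_types))
  qed
  moreover have "symp_on ?P modal_rel" if "\<forall>x. dia (box x) \<le> x \<and> x \<le> box (dia x)"
  proof (rule symp_onI)
    fix s t assume st: "s \<in> ?P" "t \<in> ?P" "modal_rel s t"
    obtain p a F q b G where "s = (p, a, F)" "t = (q, b, G)" by (cases s, cases t)
    \<comment> \<open>Use the relation at \<open>box c\<close> and \<open>dia c\<close>:
      \<open>q (box c)\<close> gives \<open>p (dia (box c))\<close>, hence \<open>p c\<close>; and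
      \<open>p c\<close> gives \<open>p (box (dia c))\<close>, hence
      \<open>q (dia c)\<close>.\<close>
    with st show "modal_rel t s"
      using rel le that by (metis (no_types))
  qed
  moreover have "transp_on ?P modal_rel" if "\<forall>x. box x \<le> box (box x) \<and> dia (dia x) \<le> dia x"
  proof (rule transp_onI)
    fix s t u assume stu: "s \<in> ?P" "t \<in> ?P" "u \<in> ?P" "modal_rel s t" "modal_rel t u"
    obtain p a F q b G r d H where "s = (p, a, F)" "t = (q, b, G)" "u = (r, d, H)"
      by (cases s, cases t, cases u)
    \<comment> \<open>The chains are \<open>p (box c)\<close>, \<open>p (box (box c))\<close>,
      \<open>q (box c)\<close>, \<open>r c\<close> and \<open>r c\<close>, \<open>q (dia c)\<close>,
      \<open>p (dia (dia c))\<close>, \<open>p (dia c)\<close>.\<close>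
    with stu show "modal_rel s u"
      using rel le that by (metis (no_types))
  qed
  ultimately show ?thesis by blast
qed

end
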